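(* Let $\Gamma$ and $\Delta$ be nonempty totally ordered sets without greatest element, and fix an element $0\in\Delta$. Suppose that $\Gamma'$ is a cofinal subset of $\Gamma$ and that $\iota\colon\Gamma'\rightarrow\Delta^\Gamma$ is an order preserving embedding. Then the image $\iota\Gamma'$ is not convex in $\Delta^\Gamma$.
   Context: Here $\Delta^\Gamma$ denotes the lexicographic power with respect to the distinguished element $0\in\Delta$: it is the set of all maps $a=(\delta_\gamma)_{\gamma\in\Gamma}$ from $\Gamma$ to $\Delta$ whose support $\mathrm{supp}(a)=\{\gamma\in\Gamma\mid\delta_\gamma\neq 0\}$ is a well ordered subset of $\Gamma$. It is totally ordered lexicographically: for distinct $a=(\delta_\gamma)$ and $b=(\delta'_\gamma)$ in $\Delta^\Gamma$, let $\gamma_0$ be the least element $\gamma$ of the well ordered set $\mathrm{supp}(a)\cup\mathrm{supp}(b)$ with $\delta_\gamma\neq\delta'_\gamma$; then $a<b$ if and only if $\delta_{\gamma_0}<\delta'_{\gamma_0}$. The element $0\in\Delta$ is an arbitrary fixed element and carries no algebraic meaning. Order preserving embeddings are strictly increasing maps. A subset $C$ of a totally ordered set is convex if $a\le x\le b$ with $a,b\in C$ implies $x\in C$. *)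

theory Defs
  imports Main
begin

text \<open>
  The parameter \<open>z\<close> is the distinguished element usually written \<open>0\<close>. It has no algebraic meaning,
  so it is an arbitrary element of the type and not the constant of class \<open>zero\<close>.
\<close>

definition supp :: "'d \<Rightarrow> ('g \<Rightarrow> 'd) \<Rightarrow> 'g set" where
  "supp z a = {\<gamma>. a \<gamma> \<noteq> z}"

definition well_ordered_subset :: "'g::linorder set \<Rightarrow> bool" where
  "well_ordered_subset S \<longleftrightarrow> well_order_on S (relation_of (\<le>) S)"

definition lex_power :: "'d \<Rightarrow> ('g::linorder \<Rightarrow> 'd) set" where
  "lex_power z = {a. well_ordered_subset (supp z a)}"

definition lex_less :: "'d::linorder \<Rightarrow> ('g::linorder \<Rightarrow> 'd) \<Rightarrow> ('g \<Rightarrow> 'd) \<Rightarrow> bool" where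
  "lex_less z a b \<longleftrightarrow>
     (\<exists>\<gamma>\<^sub>0 \<in> supp z a \<union> supp z b.
        a \<gamma>\<^sub>0 \<noteq> b \<gamma>\<^sub>0 \<and>
        (\<forall>\<gamma> \<in> supp z a \<union> supp z b. a \<gamma> \<noteq> b \<gamma> \<longrightarrow> \<gamma>\<^sub>0 \<le> \<gamma>) \<and>
        a \<gamma>\<^sub>0 < b \<gamma>\<^sub>0)"

definition lex_le :: "'d::linorder \<Rightarrow> ('g::linorder \<Rightarrow> 'd) \<Rightarrow> ('g \<Rightarrow> 'd) \<Rightarrow> bool" where
  "lex_le z a b \<longleftrightarrow> a = b \<or> lex_less z a b"

definition cofinal_subset :: "'g::linorder set \<Rightarrow> bool" where
  "cofinal_subset S \<longleftrightarrow> (\<forall>x. \<exists>y\<in>S. x \<le> y)"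

text \<open>Convexity of a subset \<open>C\<close> of the set \<open>X\<close> ordered by the reflexive relation \<open>le\<close>.\<close>

definition order_convex_in :: "'a set \<Rightarrow> ('a \<Rightarrow> 'a \<Rightarrow> bool) \<Rightarrow> 'a set \<Rightarrow> bool" where
  "order_convex_in X le C \<longleftrightarrow>
     C \<subseteq> X \<and> (\<forall>a\<in>C. \<forall>b\<in>C. \<forall>x\<in>X. le a x \<and> le x b \<longrightarrow> x \<in> C)"

lemma well_ordered_subset_iff_least:
  "well_ordered_subset S \<longleftrightarrow> (\<forall>T\<subseteq>S. T \<noteq> {} \<longrightarrow> (\<exists>m\<in>T. \<forall>x\<in>T. m \<le> x))"
proof -
  let ?r = "relation_of (\<le>) S"
  have lin: "linear_order_on S ?r"
    by (auto simp: relation_of_def linear_order_on_def partial_order_on_def preorder_on_def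
        refl_on_def trans_def antisym_def total_on_def)
  have strict: "?r - Id = {(x, y). x \<in> S \<and> y \<in> S \<and> x < y}"
    by (auto simp: relation_of_def)
  have "wf (?r - Id) \<longleftrightarrow> (\<forall>T\<subseteq>S. T \<noteq> {} \<longrightarrow> (\<exists>m\<in>T. \<forall>x\<in>T. m \<le> x))"
  proof
    assume wf: "wf (?r - Id)"
    show "\<forall>T\<subseteq>S. T \<noteq> {} \<longrightarrow> (\<exists>m\<in>T. \<forall>x\<in>T. m \<le> x)"
    proof (intro allI impI)
      fix T assume T: "T \<subseteq> S" "T \<noteq> {}"
      then obtain t where t: "t \<in> T" by blast
      obtain m where m: "m \<in> T" "\<And>y. (y, m) \<in> ?r - Id \<Longrightarrow> y \<notin> T"
        using wfE_min[OF wf t] by metis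
      have "m \<le> x" if "x \<in> T" for x
        using m(2)[of x] that T(1) m(1) unfolding strict
        by (metis (mono_tags, lifting) case_prodI mem_Collect_eq not_le subsetD)
      with m(1) show "\<exists>m\<in>T. \<forall>x\<in>T. m \<le> x" by blast
    qed
  next
    assume least: "\<forall>T\<subseteq>S. T \<noteq> {} \<longrightarrow> (\<exists>m\<in>T. \<forall>x\<in>T. m \<le> x)"
    show "wf (?r - Id)"
    proof (rule wfI_min)
      fix x :: 'a and Q assume x: "x \<in> Q"
      show "\<exists>z\<in>Q. \<forall>y. (y, z) \<in> ?r - Id \<longrightarrow> y \<notin> Q"
      proof (cases "Q \<inter> S = {}")
        case True
        then have "\<forall>y. (y, x) \<in> ?r - Id \<longrightarrow> y \<notin> Q" unfolding strict by auto
        with x show ?thesis by blast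
      next
        case False
        then obtain m where m: "m \<in> Q \<inter> S" "\<forall>x\<in>Q \<inter> S. m \<le> x"
          using least[rule_format, OF Int_lower2] by metis
        have "y \<notin> Q" if "(y, m) \<in> ?r - Id" for y
        proof
          assume "y \<in> Q"
          moreover have "y \<in> S" "y < m" using that unfolding strict by auto
          ultimately show False using m(2) leD by blast
        qed
        with m(1) show ?thesis by blast
      qed
    qed
  qed
  with lin show ?thesis
    by (simp add: well_ordered_subset_def well_order_on_def)
qed

lemma lex_less_iff:
  "lex_less z a b \<longleftrightarrow> (\<exists>\<gamma>\<^sub>0. a \<gamma>\<^sub>0 < b \<gamma>\<^sub>0 \<and> (\<forall>\<gamma><\<gamma>\<^sub>0. a \<gamma> = b \<gamma>))"
proof -
  have diff: "\<gamma> \<in> supp z a \<union> supp z b" if "a \<gamma> \<noteq> b \<gamma>" for \<gamma>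
    using that by (auto simp: supp_def)
  show ?thesis
  proof
    assume "lex_less z a b"
    then obtain p where p: "a p < b p"
      and min: "\<And>\<gamma>. \<gamma> \<in> supp z a \<union> supp z b \<Longrightarrow> a \<gamma> \<noteq> b \<gamma> \<Longrightarrow> p \<le> \<gamma>"
      unfolding lex_less_def by blast
    have "a \<gamma> = b \<gamma>" if "\<gamma> < p" for \<gamma>
      using min diff that leD by blast
    with p show "\<exists>\<gamma>\<^sub>0. a \<gamma>\<^sub>0 < b \<gamma>\<^sub>0 \<and> (\<forall>\<gamma><\<gamma>\<^sub>0. a \<gamma> = b \<gamma>)" by blast
  next
    assume "\<exists>\<gamma>\<^sub>0. a \<gamma>\<^sub>0 < b \<gamma>\<^sub>0 \<and> (\<forall>\<gamma><\<gamma>\<^sub>0. a \<gamma> = b \<gamma>)"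
    then obtain p where p: "a p < b p" "\<forall>\<gamma><p. a \<gamma> = b \<gamma>" by blast
    then have "a p \<noteq> b p" "\<forall>\<gamma>. a \<gamma> \<noteq> b \<gamma> \<longrightarrow> p \<le> \<gamma>"
      using not_le by auto
    with p(1) diff[of p] show "lex_less z a b" unfolding lex_less_def by blast
  qed
qed

lemma lex_less_irrefl: "\<not> lex_less z a a"
  by (simp add: lex_less_iff)

lemma lex_less_trans:
  assumes "lex_less z a b" "lex_less z b c"
  shows "lex_less z a c"
proof -
  from assms obtain p q where p: "a p < b p" "\<forall>\<gamma><p. a \<gamma> = b \<gamma>"
    and q: "b q < c q" "\<forall>\<gamma><q. b \<gamma> = c \<gamma>"
    by (auto simp: lex_less_iff)
  have "a (min p q) < c (min p q)"
    using p q by (cases p q rule: linorder_cases) (auto simp: min_def)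
  moreover have "\<forall>\<gamma><min p q. a \<gamma> = c \<gamma>"
    using p q by simp
  ultimately show ?thesis by (subst lex_less_iff) blast
qed

lemma lex_less_total:
  assumes "a \<in> lex_power z" "b \<in> lex_power z" "a \<noteq> b"
  shows "lex_less z a b \<or> lex_less z b a"
proof -
  let ?D = "{\<gamma>. a \<gamma> \<noteq> b \<gamma>}"
  have least: "\<exists>m\<in>T. \<forall>x\<in>T. m \<le> x"
    if "T \<subseteq> supp z a \<or> T \<subseteq> supp z b" "T \<noteq> {}" for T
    using assms that by (auto simp: lex_power_def well_ordered_subset_iff_least)
  have D: "?D = (?D \<inter> supp z a) \<union> (?D \<inter> supp z b)"
    by (auto simp: supp_def)
  have ne: "?D \<noteq> {}" using assms(3) by auto
  have "\<exists>m\<in>?D. \<forall>x\<in>?D. m \<le> x"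
  proof (cases "?D \<inter> supp z a = {} \<or> ?D \<inter> supp z b = {}")
    case True
    with D have "?D \<subseteq> supp z a \<or> ?D \<subseteq> supp z b" by blast
    then show ?thesis using ne by (rule least)
  next
    case False
    obtain m where m: "m \<in> ?D \<inter> supp z a" "\<forall>x\<in>?D \<inter> supp z a. m \<le> x"
      using least[of "?D \<inter> supp z a"] False by auto
    obtain n where n: "n \<in> ?D \<inter> supp z b" "\<forall>x\<in>?D \<inter> supp z b. n \<le> x"
      using least[of "?D \<inter> supp z b"] False by auto
    have "min m n \<in> ?D" using m(1) n(1) by (auto simp: min_def)
    moreover have "min m n \<le> x" if "x \<in> ?D" for x
      proof -
      from that D have "x \<in> ?D \<inter> supp z a \<or> x \<in> ?D \<inter> supp z b" by blast
      with m(2) n(2) show ?thesis by (auto simp: min_le_iff_disj)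
    qed
    ultimately show ?thesis by blast
  qed
  then obtain m where m: "a m \<noteq> b m" "\<And>x. a x \<noteq> b x \<Longrightarrow> m \<le> x" by blast
  have "\<forall>\<gamma><m. a \<gamma> = b \<gamma>" using m(2) by (meson leD)
  moreover have "\<forall>\<gamma><m. b \<gamma> = a \<gamma>" using calculation by simp
  moreover have "a m < b m \<or> b m < a m" using m(1) by auto
  ultimately show ?thesis unfolding lex_less_iff by blast
qed

end

theory Submission
  imports Defs
begin

text \<open>
  Suppose that the image \<open>C = \<iota> ` \<Gamma>'\<close> were convex. For \<open>a \<in> \<Gamma>'\<close> pick \<open>b > a\<close> in \<open>\<Gamma>'\<close>, let \<open>p\<close> be
  the place where \<open>\<iota> a\<close> and \<open>\<iota> b\<close> first differ, and let \<open>s a \<in> \<Gamma>'\<close> lie beyond \<open>p\<close>; both \<open>b\<close> and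
  \<open>s a\<close> exist because \<open>\<Gamma>'\<close> is cofinal and \<open>\<Gamma>\<close> has no greatest element. Since \<open>\<Delta>\<close> has
  no greatest element, the coordinates of \<open>\<iota> a\<close> can be raised. If this is done on a well ordered set \<open>A\<close> of places \<open>\<ge> s a\<close>, the result is again in the
  lexicographic power, is at least \<open>\<iota> a\<close> and stays below \<open>\<iota> b\<close>, because \<open>p\<close> is not touched. By
  convexity it is \<open>\<iota> (h a A)\<close> for some \<open>h a A \<ge> a\<close>, and \<open>h a A\<close> increases strictly when \<open>A\<close> is
  replaced by a proper end extension.

  So every \<open>h a\<close> is a strictly increasing map from the well ordered subsets of the final segment
  at \<open>s a\<close>, ordered by end extension, into the final segment at \<open>a\<close>. If the two segments
  coincided, iterating such a map would produce increasing chains of every ordinal length, which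
  is the classical contradiction. In general they differ, but one can iterate the maps for
  \<open>a, s a, s (s a), \<dots>\<close> simultaneously: the next member of the chain at \<open>a\<close> is the value of \<open>h a\<close>
  on the part of the chain at \<open>s a\<close> constructed so far. This is
  \<open>no_system_of_maps_on_well_ordered_subsets\<close>.
\<close>

section \<open>Well ordered subsets\<close>

lemma well_ordered_subset_subset:
  "well_ordered_subset S \<Longrightarrow> T \<subseteq> S \<Longrightarrow> well_ordered_subset T"
  unfolding well_ordered_subset_iff_least by (meson subset_trans)

lemma well_ordered_subset_Un:
  assumes "well_ordered_subset S" "well_ordered_subset T"
  shows "well_ordered_subset (S \<union> T)"
  unfolding well_ordered_subset_iff_least
proof (intro allI impI)
  fix U assume U: "U \<subseteq> S \<union> T" "U \<noteq> {}"
  have least: "\<exists>m\<in>V. \<forall>x\<in>V. m \<le> x" if "V \<subseteq> S \<or> V \<subseteq> T" "V \<noteq> {}" for V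
    using assms that unfolding well_ordered_subset_iff_least by blast
  show "\<exists>m\<in>U. \<forall>x\<in>U. m \<le> x"
  proof (cases "U \<inter> S = {} \<or> U \<inter> T = {}")
    case True
    with U show ?thesis by (intro least) blast+
  next
    case False
    obtain m where m: "m \<in> U \<inter> S" "\<forall>x\<in>U \<inter> S. m \<le> x"
      using least[of "U \<inter> S"] False by auto
    obtain n where n: "n \<in> U \<inter> T" "\<forall>x\<in>U \<inter> T. n \<le> x"
      using least[of "U \<inter> T"] False by auto
    have "min m n \<in> U" using m(1) n(1) by (auto simp: min_def)
    moreover have "\<forall>x\<in>U. min m n \<le> x"
      using U(1) m(2) n(2) by (auto simp: min_le_iff_disj)
    ultimately show ?thesis by blast
  qed
qed

text \<open>
  Transfinite recursion builds, for all indices \<open>i\<close> at once, a chain \<open>G \<nu> i\<close> in \<open>E i\<close>; the member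
  at stage \<open>\<nu>\<close> is \<open>h i\<close> applied to the set of earlier members of the chain for \<open>s i\<close>. The chains
  never get stuck, so their length is not bounded by the size of \<open>'a\<close>. As a supply of stages a
  well ordering of \<open>'a set\<close> is long enough, and Cantor's theorem gives the contradiction.
\<close>

lemma no_system_of_maps_on_well_ordered_subsets:
  fixes h :: "'i \<Rightarrow> 'a::linorder set \<Rightarrow> 'a" and E :: "'i \<Rightarrow> 'a set"
  assumes I: "i\<^sub>0 \<in> I" and s: "\<And>i. i \<in> I \<Longrightarrow> s i \<in> I"
    and mem: "\<And>i A. i \<in> I \<Longrightarrow> A \<subseteq> E (s i) \<Longrightarrow> well_ordered_subset A \<Longrightarrow> h i A \<in> E i"
    and mono: "\<And>i A c. i \<in> I \<Longrightarrow> A \<subseteq> E (s i) \<Longrightarrow> well_ordered_subset A \<Longrightarrow> c \<in> A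
      \<Longrightarrow> h i {x \<in> A. x < c} < h i A"
  shows False
proof -
  obtain r :: "'a set rel" where r: "well_order_on UNIV r"
    using well_order_on by (rule exE)
  define R where "R = r - Id"
  have wf: "wf R" using r by (simp add: R_def well_order_on_def)
  have total: "(\<mu>, \<nu>) \<in> R \<or> \<mu> = \<nu> \<or> (\<nu>, \<mu>) \<in> R" for \<mu> \<nu>
    using r by (auto simp: R_def well_order_on_def linear_order_on_def total_on_def)
  have trans: "trans R"
    using r unfolding R_def
    by (simp add: well_order_on_def linear_order_on_def partial_order_on_def preorder_on_def
        trans_diff_Id)
  define G where
    "G = wfrec R (\<lambda>F \<nu> i. h i ((\<lambda>\<mu>. F \<mu> (s i)) ` {\<mu>. (\<mu>, \<nu>) \<in> R}))"
  have G: "G \<nu> i = h i ((\<lambda>\<mu>. G \<mu> (s i)) ` {\<mu>. (\<mu>, \<nu>) \<in> R})" for \<nu> i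
    unfolding G_def by (subst wfrec[OF wf]) (simp add: cut_apply cong: image_cong_simp)
  have G_chain: "\<forall>i\<in>I. G \<nu> i \<in> E i \<and> (\<forall>\<mu>. (\<mu>, \<nu>) \<in> R \<longrightarrow> G \<mu> i < G \<nu> i)" for \<nu>
    using wf
  proof (induction \<nu>)
    case (less \<nu>)
    show ?case
    proof
      fix i assume i: "i \<in> I"
      define A where "A = (\<lambda>\<mu>. G \<mu> (s i)) ` {\<mu>. (\<mu>, \<nu>) \<in> R}"
      have E: "A \<subseteq> E (s i)" using less s[OF i] by (auto simp: A_def)
      have less': "G \<kappa> (s i) < G \<mu> (s i)" if "(\<mu>, \<nu>) \<in> R" "(\<kappa>, \<mu>) \<in> R" for \<kappa> \<mu>
        using less that s[OF i] by blast
      have wo: "well_ordered_subset A"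
        unfolding well_ordered_subset_iff_least
      proof (intro allI impI)
        fix T assume T: "T \<subseteq> A" "T \<noteq> {}"
        let ?N = "{\<mu>. (\<mu>, \<nu>) \<in> R \<and> G \<mu> (s i) \<in> T}"
        obtain \<kappa> where \<kappa>: "\<kappa> \<in> ?N" using T by (force simp: A_def)
        then obtain m where m: "m \<in> ?N" "\<And>\<mu>. (\<mu>, m) \<in> R \<Longrightarrow> \<mu> \<notin> ?N"
          using wfE_min[OF wf \<kappa>] by blast
        have "G m (s i) \<le> x" if x: "x \<in> T" for x
        proof -
          obtain \<mu> where \<mu>: "x = G \<mu> (s i)" "(\<mu>, \<nu>) \<in> R" using T x by (auto simp: A_def)
          with x m(2)[of \<mu>] total[of \<mu> m] have "\<mu> = m \<or> (m, \<mu>) \<in> R" by auto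
          with \<mu> less'[of \<mu> m] show ?thesis by auto
        qed
        with m(1) show "\<exists>m\<in>T. \<forall>x\<in>T. m \<le> x" by blast
      qed
      have "G \<mu> i < G \<nu> i" if \<mu>: "(\<mu>, \<nu>) \<in> R" for \<mu>
      proof -
        \<comment> \<open>The members of the chain for \<open>s i\<close> built before stage \<open>\<mu>\<close> form an initial segment of \<open>A\<close>,
          so that \<open>G \<mu> i\<close> and \<open>G \<nu> i\<close> can be compared through the monotonicity of \<open>h i\<close>.\<close>
        have "{x \<in> A. x < G \<mu> (s i)} = (\<lambda>\<kappa>. G \<kappa> (s i)) ` {\<kappa>. (\<kappa>, \<mu>) \<in> R}"
        proof (intro equalityI subsetI)
          fix x assume "x \<in> {x \<in> A. x < G \<mu> (s i)}"
          then obtain \<kappa> where \<kappa>: "x = G \<kappa> (s i)" "(\<kappa>, \<nu>) \<in> R" "G \<kappa> (s i) < G \<mu> (s i)"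
            by (auto simp: A_def)
          with total[of \<kappa> \<mu>] less'[of \<kappa> \<mu>] have "(\<kappa>, \<mu>) \<in> R" by auto
          with \<kappa>(1) show "x \<in> (\<lambda>\<kappa>. G \<kappa> (s i)) ` {\<kappa>. (\<kappa>, \<mu>) \<in> R}" by blast
        next
          fix x assume "x \<in> (\<lambda>\<kappa>. G \<kappa> (s i)) ` {\<kappa>. (\<kappa>, \<mu>) \<in> R}"
          then show "x \<in> {x \<in> A. x < G \<mu> (s i)}"
            using \<mu> less'[OF \<mu>] transD[OF trans _ \<mu>] by (auto simp: A_def)
        qed
        then have "G \<mu> i = h i {x \<in> A. x < G \<mu> (s i)}" by (simp add: G[of \<mu> i])
        also have "\<dots> < h i A" using \<mu> by (intro mono[OF i E wo]) (auto simp: A_def)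
        also have "h i A = G \<nu> i" by (simp add: G[of \<nu> i] A_def)
        finally show ?thesis .
      qed
      moreover have "G \<nu> i \<in> E i"
        using mem[OF i E wo] by (simp add: G[of \<nu> i] A_def)
      ultimately show "G \<nu> i \<in> E i \<and> (\<forall>\<mu>. (\<mu>, \<nu>) \<in> R \<longrightarrow> G \<mu> i < G \<nu> i)" by blast
    qed
  qed
  have "inj (\<lambda>\<nu>. G \<nu> i\<^sub>0)"
  proof (rule injI)
    fix \<mu> \<nu> assume "G \<mu> i\<^sub>0 = G \<nu> i\<^sub>0"
    then show "\<mu> = \<nu>" using total[of \<mu> \<nu>] G_chain I by (metis less_irrefl)
  qed
  then have "surj (inv (\<lambda>\<nu>. G \<nu> i\<^sub>0))" by (rule inj_imp_surj_inv)
  then show False using Cantors_theorem[of "UNIV :: 'a set"] by auto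
qed

section \<open>Raising coordinates\<close>

definition raise :: "'g set \<Rightarrow> ('g \<Rightarrow> 'd::{linorder, no_top}) \<Rightarrow> 'g \<Rightarrow> 'd" where
  "raise A x = (\<lambda>\<gamma>. if \<gamma> \<in> A then SOME d. x \<gamma> < d else x \<gamma>)"

lemma raise_in_lex_power:
  assumes "x \<in> lex_power z" "well_ordered_subset A"
  shows "raise A x \<in> lex_power z"
proof -
  have "supp z (raise A x) \<subseteq> supp z x \<union> A"
    by (auto simp: supp_def raise_def)
  with assms show ?thesis
    unfolding lex_power_def
    by (blast intro: well_ordered_subset_subset well_ordered_subset_Un)
qed

text \<open>
  The proper initial segments of a well ordered \<open>A\<close> are the sets \<open>{\<gamma> \<in> A. \<gamma> < c}\<close> with \<open>c \<in> A\<close>,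
  and \<open>c\<close> is the first place that is raised by \<open>A\<close> only. So raising is strictly increasing for
  end extension.
\<close>

lemma raise_segment_less:
  assumes "c \<in> A"
  shows "lex_less z (raise {\<gamma> \<in> A. \<gamma> < c} x) (raise A x)"
proof -
  have "x c < (SOME d. x c < d)" using gt_ex[of "x c"] by (rule someI_ex)
  with assms show ?thesis
    unfolding lex_less_iff by (intro exI[of _ c]) (auto simp: raise_def)
qed

lemma raise_ge:
  assumes "well_ordered_subset A"
  shows "lex_le z x (raise A x)"
proof (cases "A = {}")
  case True
  then show ?thesis by (simp add: lex_le_def raise_def)
next
  case False
  then obtain m where m: "m \<in> A" "\<forall>\<gamma>\<in>A. m \<le> \<gamma>"
    using assms unfolding well_ordered_subset_iff_least by blast
  \<comment> \<open>The empty set is the initial segment of \<open>A\<close> at \<open>m\<close>.\<close>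
  then have "raise {\<gamma> \<in> A. \<gamma> < m} x = x" by (auto simp: raise_def fun_eq_iff)
  with raise_segment_less[OF m(1), of z x] show ?thesis by (simp add: lex_le_def)
qed

text \<open>
  Raising beyond the first difference \<open>p\<close> of \<open>x\<close> and \<open>y\<close> cannot carry \<open>x\<close> past \<open>y\<close>, however
  large the new values are.
\<close>

lemma raise_beyond_less:
  assumes "x p < y p" "\<forall>\<gamma><p. x \<gamma> = y \<gamma>" "\<forall>\<gamma>\<in>A. p < \<gamma>"
  shows "lex_less z (raise A x) y"
  unfolding lex_less_iff using assms by (intro exI[of _ p]) (auto simp: raise_def)

section \<open>The image is not convex\<close>

theorem theorem2:
  fixes z :: "'d :: {linorder, no_top}"
    and \<Gamma>' :: "'g :: {linorder, no_top} set"
    and \<iota> :: "'g \<Rightarrow> ('g \<Rightarrow> 'd)"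
  assumes "cofinal_subset \<Gamma>'"
    and "\<iota> ` \<Gamma>' \<subseteq> lex_power z"
    and "monotone_on \<Gamma>' (<) (lex_less z) \<iota>"
  shows "\<not> order_convex_in (lex_power z) (lex_le z) (\<iota> ` \<Gamma>')"
proof
  assume convex: "order_convex_in (lex_power z) (lex_le z) (\<iota> ` \<Gamma>')"
  have beyond: "\<exists>b\<in>\<Gamma>'. a < b" for a
  proof -
    obtain c where "a < c" using gt_ex by blast
    moreover obtain b where "b \<in> \<Gamma>'" "c \<le> b"
      using assms(1) unfolding cofinal_subset_def by blast
    ultimately show ?thesis by (blast intro: less_le_trans)
  qed
  have mono: "lex_less z (\<iota> a) (\<iota> b)" if "a \<in> \<Gamma>'" "b \<in> \<Gamma>'" "a < b" for a b
    using assms(3) that unfolding monotone_on_def by blast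
  have reflect_less: "a < b" if "a \<in> \<Gamma>'" "b \<in> \<Gamma>'" "lex_less z (\<iota> a) (\<iota> b)" for a b
    using that mono[of b a] lex_less_trans lex_less_irrefl
    by (cases a b rule: linorder_cases) blast+

  have "\<exists>a'\<in>\<Gamma>'. \<exists>b\<in>\<Gamma>'. \<exists>p<a'. \<iota> a p < \<iota> b p \<and> (\<forall>\<gamma><p. \<iota> a \<gamma> = \<iota> b \<gamma>)"
    if a: "a \<in> \<Gamma>'" for a
  proof -
    obtain b where b: "b \<in> \<Gamma>'" "a < b" using beyond by blast
    obtain p where "\<iota> a p < \<iota> b p" "\<forall>\<gamma><p. \<iota> a \<gamma> = \<iota> b \<gamma>"
      using mono[OF a b] unfolding lex_less_iff by blast
    then show ?thesis using beyond[of p] b(1) by blast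
  qed
  then obtain s where s: "\<And>a. a \<in> \<Gamma>' \<Longrightarrow> s a \<in> \<Gamma>'" and
    first_diff: "\<And>a. a \<in> \<Gamma>' \<Longrightarrow>
      \<exists>b\<in>\<Gamma>'. \<exists>p<s a. \<iota> a p < \<iota> b p \<and> (\<forall>\<gamma><p. \<iota> a \<gamma> = \<iota> b \<gamma>)"
    by metis

  have in_image: "raise A (\<iota> a) \<in> \<iota> ` \<Gamma>'"
    if a: "a \<in> \<Gamma>'" and A: "A \<subseteq> {s a..}" "well_ordered_subset A" for a A
  proof -
    obtain b p where b: "b \<in> \<Gamma>'" and
      p: "p < s a" "\<iota> a p < \<iota> b p" "\<forall>\<gamma><p. \<iota> a \<gamma> = \<iota> b \<gamma>"
      using first_diff[OF a] by blast
    have "\<forall>\<gamma>\<in>A. p < \<gamma>" using A(1) p(1) by (auto intro: less_le_trans)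
    then have "lex_le z (raise A (\<iota> a)) (\<iota> b)"
      using raise_beyond_less[of "\<iota> a" p "\<iota> b"] p(2,3) by (auto simp: lex_le_def)
    moreover have "lex_le z (\<iota> a) (raise A (\<iota> a))" using A(2) by (rule raise_ge)
    moreover have "raise A (\<iota> a) \<in> lex_power z"
      using assms(2) a A(2) by (intro raise_in_lex_power) auto
    ultimately show ?thesis
      using convex a b unfolding order_convex_in_def by blast
  qed

  define h where "h a A = inv_into \<Gamma>' \<iota> (raise A (\<iota> a))" for a A
  have h: "h a A \<in> \<Gamma>'" "\<iota> (h a A) = raise A (\<iota> a)"
    if "a \<in> \<Gamma>'" "A \<subseteq> {s a..}" "well_ordered_subset A" for a A
    using in_image[OF that] by (auto simp: h_def inv_into_into f_inv_into_f)

  obtain a\<^sub>0 where "a\<^sub>0 \<in> \<Gamma>'" using beyond by blast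
  then show False
  proof (rule no_system_of_maps_on_well_ordered_subsets[where h = h and s = s and E = atLeast])
    fix a assume a: "a \<in> \<Gamma>'"
    then show "s a \<in> \<Gamma>'" by (rule s)
    fix A assume A: "A \<subseteq> {s a..}" "well_ordered_subset A"
    have "\<not> h a A < a"
    proof
      assume "h a A < a"
      then have "lex_less z (raise A (\<iota> a)) (\<iota> a)"
        using mono[OF h(1)[OF a A] a] h(2)[OF a A] by simp
      with raise_ge[OF A(2), of z "\<iota> a"] show False
        by (metis lex_le_def lex_less_irrefl lex_less_trans)
    qed
    then show "h a A \<in> {a..}" by simp
    fix c assume c: "c \<in> A"
    have A': "{\<gamma> \<in> A. \<gamma> < c} \<subseteq> {s a..}" "well_ordered_subset {\<gamma> \<in> A. \<gamma> < c}"
      using A by (auto intro: well_ordered_subset_subset)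
    show "h a {\<gamma> \<in> A. \<gamma> < c} < h a A"
      using h[OF a A] h[OF a A'] raise_segment_less[OF c] by (intro reflect_less) auto
  qed
qed

end
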